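(* Let $n\ge 1$ and let $\Sigma\subset \mathbf{O}(n)$ be the group of the $2^n$ diagonal $n\times n$ matrices all of whose diagonal entries are $\pm 1$. A matrix $A\in\mathbb{R}^{n,n}$ is self-adjoint (i.e. $A=A^T$) if and only if there is an orthogonal matrix $V\in\mathbf{O}(n)$ such that $$\gamma A = A\gamma \quad \text{for all } \gamma\in\Gamma,$$ where the group $\Gamma\subset\mathbf{O}(n)$ is defined by $$\Gamma=\{V^T\sigma V : \sigma\in\Sigma\}.$$
   Context: $\mathbb{R}^{n,n}$ denotes the set of real $n\times n$ matrices and $\mathbf{O}(n)$ the group of real orthogonal $n\times n$ matrices. *)

theory Defs
  imports "HOL-Analysis.Analysis"
begin

definition orthogonal_group :: "(real ^ 'n ^ 'n) set"
  where "orthogonal_group = {Q. orthogonal_matrix Q}"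

definition sign_group :: "(real ^ 'n ^ 'n) set"
  where "sign_group =
    {S. (\<forall>i j. i \<noteq> j \<longrightarrow> S $ i $ j = 0) \<and> (\<forall>i. S $ i $ i = 1 \<or> S $ i $ i = - 1)}"

definition conj_sign_group :: "real ^ 'n ^ 'n \<Rightarrow> (real ^ 'n ^ 'n) set"
  where "conj_sign_group V = {transpose V ** S ** V | S. S \<in> sign_group}"

definition self_adjoint_matrix :: "real ^ 'n ^ 'n \<Rightarrow> bool"
  where "self_adjoint_matrix A \<longleftrightarrow> A = transpose A"

lemma sign_group_eq_range:
  "sign_group = range (\<lambda>I :: 'n::finite set. \<chi> i j. if i = j then (if i \<in> I then - 1 else 1) else (0::real))"
proof (intro equalityI subsetI)
  fix S :: "real ^ 'n ^ 'n" assume S: "S \<in> sign_group"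
  have "S = (\<chi> i j. if i = j then (if i \<in> {k. S $ k $ k = - 1} then - 1 else 1) else 0)"
    using S by (auto simp: sign_group_def vec_eq_iff)
  then show "S \<in> range (\<lambda>I :: 'n set. \<chi> i j. if i = j then (if i \<in> I then - 1 else 1) else 0)"
    by blast
qed (auto simp: sign_group_def)

lemma card_sign_group: "card (sign_group :: (real ^ 'n::finite ^ 'n) set) = 2 ^ CARD('n)"
proof -
  have "inj (\<lambda>I :: 'n set. \<chi> i j. if i = j then (if i \<in> I then - 1 else 1) else (0::real))"
  proof (rule injI)
    fix I J :: "'n set"
    assume eq: "(\<chi> i j. if i = j then (if i \<in> I then - 1 else 1) else (0::real)) =
      (\<chi> i j. if i = j then (if i \<in> J then - 1 else 1) else 0)"
    have "k \<in> I \<longleftrightarrow> k \<in> J" for k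
      using arg_cong[OF eq, of "\<lambda>M. M $ k $ k"] by (auto split: if_splits)
    then show "I = J" by blast
  qed
  then show ?thesis
    unfolding sign_group_eq_range
    by (simp add: card_image card_Pow flip: Pow_UNIV)
qed

lemma sign_group_one: "mat 1 \<in> sign_group"
  by (simp add: sign_group_def mat_def)

lemma sign_group_transpose: "S \<in> sign_group \<Longrightarrow> transpose S = S"
proof -
  assume S: "S \<in> sign_group"
  have "S $ j $ i = S $ i $ j" for i j
    using S by (cases "i = j") (simp_all add: sign_group_def)
  then show ?thesis by (simp add: transpose_def vec_eq_iff)
qed

lemma sign_group_mult_nth:
  assumes "S \<in> sign_group"
  shows "(S ** T) $ i $ j = S $ i $ i * T $ i $ j"
proof -
  have "(\<Sum>k\<in>UNIV. S $ i $ k * T $ k $ j) = (\<Sum>k\<in>UNIV. if k = i then S $ i $ i * T $ i $ j else 0)"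
    using assms by (intro sum.cong) (auto simp: sign_group_def)
  then show ?thesis by (simp add: matrix_matrix_mult_def)
qed

lemma sign_group_mult:
  assumes "S \<in> sign_group" "T \<in> sign_group"
  shows "S ** T \<in> sign_group"
proof -
  have S: "S $ i $ i = 1 \<or> S $ i $ i = - 1" for i
    using assms(1) by (simp add: sign_group_def)
  have T: "T $ i $ i = 1 \<or> T $ i $ i = - 1" "i \<noteq> j \<Longrightarrow> T $ i $ j = 0" for i j
    using assms(2) by (simp_all add: sign_group_def)
  have "S $ i $ i * T $ i $ i = 1 \<or> S $ i $ i * T $ i $ i = - 1" for i
    using S[of i] T(1)[of i] by auto
  then show ?thesis
    unfolding sign_group_def by (simp add: sign_group_mult_nth[OF assms(1)] T(2))
qed

lemma sign_group_square: "S \<in> sign_group \<Longrightarrow> S ** S = mat 1"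
proof -
  assume S: "S \<in> sign_group"
  have "S $ i $ i * S $ i $ j = (if i = j then 1 else 0)" for i j
  proof (cases "i = j")
    case True
    have "S $ i $ i = 1 \<or> S $ i $ i = - 1" using S by (simp add: sign_group_def)
    then show ?thesis using True by auto
  next
    case False
    then show ?thesis using S by (simp add: sign_group_def)
  qed
  then show ?thesis by (simp add: vec_eq_iff mat_def sign_group_mult_nth[OF S])
qed

lemma sign_group_subset: "sign_group \<subseteq> orthogonal_group"
  by (auto simp: orthogonal_group_def orthogonal_matrix sign_group_transpose sign_group_square)

lemma conj_sign_group_subset:
  assumes "V \<in> orthogonal_group"
  shows "conj_sign_group V \<subseteq> orthogonal_group"
  using assms sign_group_subset
  by (auto simp: conj_sign_group_def orthogonal_group_def intro!: orthogonal_matrix_mul)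

lemma conj_sign_group_one:
  assumes "V \<in> orthogonal_group"
  shows "mat 1 \<in> conj_sign_group V"
proof -
  have "mat 1 = transpose V ** mat 1 ** V"
    using assms by (simp add: orthogonal_group_def orthogonal_matrix)
  then show ?thesis using sign_group_one unfolding conj_sign_group_def by blast
qed

lemma conj_sign_group_mult:
  assumes V: "V \<in> orthogonal_group" and "g \<in> conj_sign_group V" "h \<in> conj_sign_group V"
  shows "g ** h \<in> conj_sign_group V"
proof -
  obtain S T where S: "S \<in> sign_group" "g = transpose V ** S ** V"
    and T: "T \<in> sign_group" "h = transpose V ** T ** V"
    using assms by (auto simp: conj_sign_group_def)
  have "g ** h = transpose V ** S ** (V ** transpose V) ** T ** V"
    unfolding S T by (simp only: matrix_mul_assoc)
  also have "\<dots> = transpose V ** (S ** T) ** V"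
    using V by (simp add: orthogonal_group_def orthogonal_matrix_def matrix_mul_assoc)
  finally show ?thesis
    using sign_group_mult[OF S(1) T(1)] unfolding conj_sign_group_def by blast
qed

lemma conj_sign_group_transpose:
  assumes "g \<in> conj_sign_group V"
  shows "transpose g = g"
  using assms
  by (auto simp: conj_sign_group_def matrix_transpose_mul sign_group_transpose matrix_mul_assoc)

end

theory Submission
  imports Defs
begin

text \<open>
  If \<open>A\<close> is self-adjoint, let the rows of \<open>V\<close> be an orthonormal eigenbasis of \<open>A\<close>: every \<open>V\<^sup>T \<sigma> V\<close>
  is then diagonal in the same basis as \<open>A\<close>. The eigenbasis is built by maximising the quadratic
  form of \<open>A\<close> over the unit sphere of an invariant subspace and passing to the orthogonal
  complement. Conversely, \<open>V A V\<^sup>T\<close> commutes with all sign matrices, which forces it to be diagonal,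
  so \<open>A\<close> is symmetric.
\<close>

text \<open>A maximiser \<open>v\<close> of \<open>x \<bullet> f x\<close> on the unit sphere of
  \<open>S\<close>, with maximum \<open>c\<close>, makes
  \<open>c * (x \<bullet> x) - x \<bullet> f x\<close> nonnegative on \<open>S\<close> and zero at
  \<open>v\<close>. Stationarity at \<open>v\<close> then forces the residual
  \<open>f v - c *\<^sub>R v\<close> to vanish.\<close>

lemma symmetric_linear_eigenvector:
  fixes f :: "'a::euclidean_space \<Rightarrow> 'a"
  assumes f: "linear f" and sym: "\<And>x y. f x \<bullet> y = x \<bullet> f y"
    and S: "subspace S" "f ` S \<subseteq> S" "S \<noteq> {0}"
  obtains v c where "v \<in> S" "norm v = 1" "f v = c *\<^sub>R v"
proof -
  interpret f: linear f by (rule f)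
  have "compact (sphere 0 1 \<inter> S)"
    by (intro compact_Int_closed compact_sphere closed_subspace S)
  moreover have "sphere 0 1 \<inter> S \<noteq> {}"
  proof -
    obtain x where x: "x \<in> S" "x \<noteq> 0"
      using S(1,3) subspace_0 by blast
    then have "(inverse (norm x)) *\<^sub>R x \<in> sphere 0 1 \<inter> S"
      using S(1) by (simp add: subspace_scale)
    then show ?thesis by blast
  qed
  moreover have "continuous_on (sphere 0 1 \<inter> S) (\<lambda>x. x \<bullet> f x)"
    by (intro continuous_intros linear_continuous_on linear_conv_bounded_linear[THEN iffD1] f)
  ultimately obtain v where "v \<in> sphere 0 1 \<inter> S"
    and "\<forall>x\<in>sphere 0 1 \<inter> S. x \<bullet> f x \<le> v \<bullet> f v"
    using continuous_attains_sup by metis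
  then have v: "v \<in> S" "norm v = 1"
    and max: "\<And>x. x \<in> S \<Longrightarrow> norm x = 1 \<Longrightarrow> x \<bullet> f x \<le> v \<bullet> f v"
    by auto
  define c where "c = v \<bullet> f v"
  \<comment> \<open>Homogeneity of degree two carries the bound from the unit sphere to all of
    \<open>S\<close>.\<close>
  have nonneg: "c * (x \<bullet> x) - x \<bullet> f x \<ge> 0" if "x \<in> S" for x
  proof (cases "x = 0")
    case False
    have "inverse (norm x) *\<^sub>R x \<in> S"
      using that S(1) by (simp add: subspace_scale)
    from max[OF this] False have "(inverse (norm x))\<^sup>2 * (x \<bullet> f x) \<le> c"
      by (simp add: f.scale c_def power2_eq_square mult.assoc)
    with False show ?thesis
      by (simp add: field_simps power2_norm_eq_inner)
  qed (simp add: f.zero)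
  \<comment> \<open>The residual is itself an admissible direction: \<open>S\<close> is invariant,
    so it contains \<open>w\<close>.\<close>
  define w where "w = f v - c *\<^sub>R v"
  have w: "w \<in> S"
    unfolding w_def using v(1) S by (auto intro!: subspace_diff subspace_scale)
  define d where "d = c * (w \<bullet> w) - w \<bullet> f w"
  have "d \<ge> 0" unfolding d_def using nonneg[OF w] .
  \<comment> \<open>The first variation of the nonnegative form at its zero \<open>v\<close>, in the direction \<open>w\<close>.\<close>
  have quadratic: "0 \<le> t\<^sup>2 * d - 2 * t * (w \<bullet> w)" for t
  proof -
    have "v \<bullet> v = 1" using v(2) by (simp add: norm_eq_1)
    \<comment> \<open>Since \<open>f v = w + c *\<^sub>R v\<close>, the linear coefficient
      \<open>2 * c * (v \<bullet> w) - 2 * (w \<bullet> f v)\<close> collapses to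
      \<open>- 2 * (w \<bullet> w)\<close>.\<close>
    have "w \<bullet> f v = w \<bullet> w + c * (v \<bullet> w)"
      by (simp add: w_def algebra_simps inner_commute)
    moreover have "v \<bullet> f w = w \<bullet> f v"
      by (metis sym inner_commute)
    ultimately have "c * ((v + t *\<^sub>R w) \<bullet> (v + t *\<^sub>R w)) - (v + t *\<^sub>R w) \<bullet> f (v + t *\<^sub>R w)
        = t\<^sup>2 * d - 2 * t * (w \<bullet> w)"
      using \<open>v \<bullet> v = 1\<close>
      by (simp add: f.add f.scale d_def c_def[symmetric] inner_commute[of w v] power2_eq_square
          algebra_simps)
    moreover have "v + t *\<^sub>R w \<in> S"
      using v(1) w S(1) by (intro subspace_add subspace_scale)
    ultimately show ?thesis using nonneg by metis
  qed
  have "w \<bullet> w = 0"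
  proof -
    \<comment> \<open>The vertex of the parabola is at \<open>?b / d\<close>; the denominator
      \<open>d + 1\<close> also covers \<open>d = 0\<close> and still gives a negative value unless
      \<open>?b = 0\<close>.\<close>
    let ?b = "w \<bullet> w" and ?t = "(w \<bullet> w) / (d + 1)"
    have "?t\<^sup>2 * d - 2 * ?t * ?b = - (?b\<^sup>2 * (d + 2)) / (d + 1)\<^sup>2"
      using \<open>d \<ge> 0\<close> by (simp add: divide_simps power2_eq_square) (simp add: algebra_simps)
    then have "?b\<^sup>2 * (d + 2) / (d + 1)\<^sup>2 \<le> 0"
      using quadratic[of ?t] by simp
    then have "?b\<^sup>2 * (d + 2) \<le> 0"
      using \<open>d \<ge> 0\<close> by (simp add: divide_le_0_iff)
    then have "?b\<^sup>2 \<le> 0"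
      using \<open>d \<ge> 0\<close> by (simp add: mult_le_0_iff)
    then show ?thesis by simp
  qed
  then have "f v = c *\<^sub>R v" by (simp add: w_def)
  with v show ?thesis by (rule that)
qed

text \<open>Induction on \<open>dim S\<close>: split off a unit eigenvector and continue in its
  orthogonal complement within \<open>S\<close>. A general invariant \<open>S\<close> is what lets
  the induction run.\<close>

lemma symmetric_linear_orthonormal_eigenbasis:
  fixes f :: "'a::euclidean_space \<Rightarrow> 'a"
  assumes f: "linear f" and sym: "\<And>x y. f x \<bullet> y = x \<bullet> f y"
    and "subspace S" "f ` S \<subseteq> S"
  shows "\<exists>B. pairwise orthogonal B \<and> (\<forall>b\<in>B. norm b = 1) \<and> span B = S \<and> (\<forall>b\<in>B. \<exists>c. f b = c *\<^sub>R b)"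
  using assms(3,4)
proof (induction "dim S" arbitrary: S rule: less_induct)
  case less
  show ?case
  proof (cases "S = {0}")
    case True
    then show ?thesis by (intro exI[of _ "{}"]) simp
  next
    case False
    then obtain v c where v: "v \<in> S" "norm v = 1" "f v = c *\<^sub>R v"
      using symmetric_linear_eigenvector[OF f sym less.prems] by blast
    have vv: "v \<bullet> v = 1" using v(2) by (simp add: norm_eq_1)
    define T where "T = S \<inter> {x. v \<bullet> x = 0}"
    have T: "subspace T"
      unfolding T_def by (intro subspace_inter less.prems subspace_hyperplane)
    \<comment> \<open>By symmetry
      \<open>v \<bullet> f x = f v \<bullet> x = c * (v \<bullet> x) = 0\<close>.\<close>
    have "f x \<in> T" if "x \<in> T" for x
      using that less.prems(2) sym[of v x] v(3) by (auto simp: T_def)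
    then have fT: "f ` T \<subseteq> T" by blast
    have "v \<notin> T" using vv by (simp add: T_def)
    moreover have "T \<subseteq> S" by (simp add: T_def)
    ultimately have "T \<subset> S" using v(1) by blast
    moreover have "span T = T" "span S = S"
      using T less.prems(1) by (auto simp only: span_eq_iff)
    ultimately have "dim T < dim S"
      by (metis dim_psubset)
    from less.hyps[OF this T fT] obtain B where B: "pairwise orthogonal B"
      "\<forall>b\<in>B. norm b = 1" "span B = T" "\<forall>b\<in>B. \<exists>c. f b = c *\<^sub>R b" by blast
    have BT: "B \<subseteq> T" using B(3) span_superset by blast
    have "span (insert v B) = S"
    proof
      show "span (insert v B) \<subseteq> S"
        using BT v(1) less.prems(1) by (intro span_minimal) (auto simp: T_def)
      show "S \<subseteq> span (insert v B)"
      proof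
        fix x assume "x \<in> S"
        then have "x - (v \<bullet> x) *\<^sub>R v \<in> T"
          using less.prems(1) v(1) vv
          by (auto simp: T_def algebra_simps intro!: subspace_diff subspace_scale)
        then show "x \<in> span (insert v B)"
          unfolding span_breakdown_eq B(3) by blast
      qed
    qed
    moreover have "pairwise orthogonal (insert v B)"
      using B(1) BT by (auto simp: pairwise_insert orthogonal_def T_def inner_commute)
    ultimately show ?thesis
      using B(2,4) v(2,3) by (intro exI[of _ "insert v B"]) auto
  qed
qed

text \<open>The rows of \<open>V\<close> are an orthonormal eigenbasis indexed by \<open>'n\<close>;
  the equation says \<open>V ** A = diag(c) ** V\<close>.\<close>

lemma symmetric_matrix_diagonalizable:
  fixes A :: "real ^ 'n ^ 'n"
  assumes A: "transpose A = A"
  obtains V c where "orthogonal_matrix V" "V ** A = (\<chi> i j. c i * V $ i $ j)"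
proof -
  have sym: "(A *v x) \<bullet> y = x \<bullet> (A *v y)" for x y
    using A dot_lmul_matrix[of x A y] by (metis transpose_matrix_vector)
  obtain B where B: "pairwise orthogonal B" "\<forall>b\<in>B. norm b = 1" "span B = UNIV"
      "\<forall>b\<in>B. \<exists>c. A *v b = c *\<^sub>R b"
    using symmetric_linear_orthonormal_eigenbasis[of "(*v) A" UNIV] sym by auto
  have "independent B"
    using B(1,2) by (intro pairwise_orthogonal_independent) auto
  then have "card B = CARD('n)" "finite B"
    using dim_span_eq_card_independent[of B] B(3) independent_bound[of B] by auto
  then obtain b where b: "bij_betw b (UNIV :: 'n set) B"
    by (metis finite_same_card_bij finite_class.finite_UNIV)
  then have bB: "b i \<in> B" for i by (auto simp: bij_betw_def)
  then have "\<forall>i. \<exists>c. A *v b i = c *\<^sub>R b i"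
    using B(4) by blast
  from choice[OF this] obtain c where c: "\<And>i. A *v b i = c i *\<^sub>R b i"
    by blast
  define V where "V = (\<chi> i. b i)"
  have row_V: "row i V = b i" for i
    by (simp add: V_def row_def vec_eq_iff)
  have "orthogonal (b i) (b j)" if "i \<noteq> j" for i j
    using B(1) bB that bij_betw_imp_inj_on[OF b] by (metis injD pairwiseD)
  then have "orthogonal_matrix V"
    by (simp add: orthogonal_matrix_orthonormal_rows row_V B(2)[rule_format] bB)
  moreover have "(V ** A) $ i $ j = c i * V $ i $ j" for i j
  proof -
    \<comment> \<open>Symmetry turns row \<open>i\<close> of \<open>V ** A\<close> into
      \<open>A *v b i\<close>.\<close>
    have "A $ k $ j = A $ j $ k" for k
      using arg_cong[OF A, of "\<lambda>M. M $ j $ k"] by (simp add: transpose_def)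
    then have "(V ** A) $ i $ j = (A *v b i) $ j"
      by (simp add: V_def matrix_matrix_mult_def matrix_vector_mult_def mult.commute)
    then show ?thesis by (simp add: c V_def)
  qed
  ultimately show ?thesis
    by (intro that[of V c]) (simp_all add: vec_eq_iff)
qed

text \<open>Flip the sign of coordinate \<open>i\<close> alone: from the left this negates the entry
  at \<open>(i, j)\<close>, from the right it leaves it unchanged.\<close>

lemma commutes_sign_group_imp_diagonal:
  fixes M :: "real ^ 'n ^ 'n"
  assumes comm: "\<And>S. S \<in> sign_group \<Longrightarrow> S ** M = M ** S" and "i \<noteq> j"
  shows "M $ i $ j = 0"
proof -
  define S :: "real ^ 'n ^ 'n"
    where "S = (\<chi> k l. if k = l then (if k = i then - 1 else 1) else 0)"
  have S: "S \<in> sign_group" by (simp add: S_def sign_group_def)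
  have "(M ** S) $ i $ j = M $ i $ j"
    using \<open>i \<noteq> j\<close> by (simp add: S_def matrix_matrix_mult_def if_distrib cong: if_cong)
  moreover have "(S ** M) $ i $ j = - M $ i $ j"
    by (simp add: sign_group_mult_nth[OF S]) (simp add: S_def)
  ultimately show ?thesis using comm[OF S] by simp
qed

theorem proposition2p1:
  fixes A :: "real ^ 'n ^ 'n"
  shows "self_adjoint_matrix A \<longleftrightarrow>
    (\<exists>V \<in> orthogonal_group. \<forall>\<gamma> \<in> conj_sign_group V. \<gamma> ** A = A ** \<gamma>)"
proof
  assume "self_adjoint_matrix A"
  then have A: "transpose A = A" by (simp add: self_adjoint_matrix_def)
  then obtain V c where V: "orthogonal_matrix V" and VA: "V ** A = (\<chi> i j. c i * V $ i $ j)"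
    by (rule symmetric_matrix_diagonalizable)
  have "g ** A = A ** g" if g: "g \<in> conj_sign_group V" for g
  proof -
    obtain S where S: "S \<in> sign_group" and gS: "g = transpose V ** S ** V"
      using g by (auto simp: conj_sign_group_def)
    \<comment> \<open>Both \<open>g\<close> and \<open>A\<close> are symmetric, so they commute once \<open>g ** A\<close> is symmetric.\<close>
    define D where "D = (\<chi> i j. if i = j then S $ i $ i * c i else 0)"
    \<comment> \<open>\<open>D\<close> is the product of \<open>S\<close> with the diagonal matrix
      of \<open>c\<close>.\<close>
    have "S ** (V ** A) = D ** V"
      by (simp add: vec_eq_iff sign_group_mult_nth[OF S] VA)
        (simp add: D_def matrix_matrix_mult_def if_distrib if_distribR cong: if_cong)
    then have gA: "g ** A = transpose V ** D ** V"
      by (simp add: gS flip: matrix_mul_assoc)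
    have "transpose D = D" by (auto simp: D_def transpose_def vec_eq_iff)
    then have "transpose (g ** A) = g ** A"
      by (simp add: gA matrix_transpose_mul matrix_mul_assoc)
    then show ?thesis
      by (simp add: matrix_transpose_mul A conj_sign_group_transpose[OF g])
  qed
  then show "\<exists>V \<in> orthogonal_group. \<forall>\<gamma> \<in> conj_sign_group V. \<gamma> ** A = A ** \<gamma>"
    using V by (auto simp: orthogonal_group_def)
next
  assume "\<exists>V \<in> orthogonal_group. \<forall>\<gamma> \<in> conj_sign_group V. \<gamma> ** A = A ** \<gamma>"
  then obtain V where V: "V ** transpose V = mat 1" "transpose V ** V = mat 1"
    and comm: "\<And>g. g \<in> conj_sign_group V \<Longrightarrow> g ** A = A ** g"
    by (auto simp: orthogonal_group_def orthogonal_matrix_def)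
  \<comment> \<open>Conjugation by \<open>V\<close> turns \<open>transpose V ** S ** V\<close> back
    into \<open>S\<close> and \<open>A\<close> into \<open>M\<close>, so the hypothesis becomes
    commutation of \<open>M\<close> with every sign matrix.\<close>
  define M where "M = V ** A ** transpose V"
  have cancel: "V ** (transpose V ** X) = X" "transpose V ** (V ** X) = X" for X :: "real ^ 'n ^ 'n"
    by (simp_all add: V matrix_mul_assoc)
  have "S ** M = M ** S" if "S \<in> sign_group" for S
  proof -
    have "transpose V ** S ** V \<in> conj_sign_group V"
      using that by (auto simp: conj_sign_group_def)
    from comm[OF this]
    have "V ** (transpose V ** S ** V ** A) ** transpose V = V ** (A ** (transpose V ** S ** V)) ** transpose V"
      by simp
    then show ?thesis
      by (simp add: M_def cancel V flip: matrix_mul_assoc)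
  qed
  then have "M $ i $ j = 0" if "i \<noteq> j" for i j
    using that by (rule commutes_sign_group_imp_diagonal)
  then have "transpose M = M"
    by (simp add: transpose_def vec_eq_iff) metis
  moreover have A: "A = transpose V ** M ** V"
    by (simp add: M_def cancel V flip: matrix_mul_assoc)
  ultimately show "self_adjoint_matrix A"
    by (simp add: self_adjoint_matrix_def matrix_transpose_mul matrix_mul_assoc)
qed

end
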